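(* For every positive integer $n$, the polynomial $R_n(x)=\sum_{k=1}^{n-1}R(n,k)x^k$ has log-concave coefficients; that is, writing $c_k$ for the coefficient of $x^k$ in $R_n(x)$ (with $c_k=0$ when $k\le 0$ or $k\ge n$), we have $c_{k-1}\,c_{k+1}\le c_k^2$ for all $k\geq 1$.
   Context: An $n$-permutation is a permutation $p=p_1p_2\cdots p_n$ of $\{1,2,\ldots,n\}$ in one-line notation. For $2\le i\le n-1$, $p$ changes direction at position $i$ if either $p_{i-1}<p_i>p_{i+1}$ or $p_{i-1}>p_i<p_{i+1}$. The permutation $p$ has $k$ runs if there are exactly $k-1$ positions at which $p$ changes direction. $R(n,k)$ denotes the number of $n$-permutations having $k$ runs. *)

theory Defs
  imports
    "HOL-Combinatorics.Permutations"
    "HOL-Computational_Algebra.Polynomial"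
begin

definition changes_direction_at :: "(nat \<Rightarrow> nat) \<Rightarrow> nat \<Rightarrow> bool" where
  "changes_direction_at p i \<longleftrightarrow>
     (p (i - 1) < p i \<and> p i > p (i + 1)) \<or> (p (i - 1) > p i \<and> p i < p (i + 1))"

definition runs :: "nat \<Rightarrow> (nat \<Rightarrow> nat) \<Rightarrow> nat" where
  "runs n p = card {i \<in> {2..n - 1}. changes_direction_at p i} + 1"

text \<open>An \<open>n\<close>-permutation in one-line notation \<open>p\<^sub>1 \<dots> p\<^sub>n\<close> is a function \<open>p\<close> with
  \<open>p permutes {1..n}\<close>, where \<open>p\<^sub>i\<close> is \<open>p i\<close>.\<close>

definition R :: "nat \<Rightarrow> nat \<Rightarrow> nat" where
  "R n k = card {p. p permutes {1..n} \<and> runs n p = k}"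

text \<open>For \<open>n = 1\<close> the sum is empty, so \<open>run_poly 1 = 0\<close> although \<open>R 1 1 = 1\<close>.\<close>

definition run_poly :: "nat \<Rightarrow> int poly" where
  "run_poly n = (\<Sum>k=1..n - 1. monom (int (R n k)) k)"

end

theory Submission
  imports Defs "HOL-Combinatorics.Multiset_Permutations"
begin

text \<open>
  Write \<open>R\<^sub>n(x) = x P\<^sub>n(x)\<close>, so that \<open>P\<^sub>n\<close> (below, \<open>turn_poly\<close>) counts permutations by their
  number of changes of direction. Inserting the new maximum into a permutation of length
  \<open>N + 2\<close> with \<open>c\<close> changes of direction creates no new change in \<open>c + 1\<close> places, one new
  change in \<open>2\<close> places and two new ones in the remaining \<open>N - c\<close> places
  (\<open>sum_turns_insert\<close>), whence
  \<open>P\<^bsub>N+3\<^esub> = (1 + 2x + N x\<^sup>2) P\<^bsub>N+2\<^esub> + (x - x\<^sup>3) P\<^bsub>N+2\<^esub>'\<close>.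

  The three-term recurrence that this gives for the coefficients does not preserve
  log-concavity in any evident way. In the basis \<open>x\<^sup>k (1 + x)\<^bsup>N-k\<^esup>\<close>, however, it becomes
  a two-term recurrence with linear coefficients: \<open>P\<^bsub>N+2\<^esub> = \<Sum>\<^sub>k g\<^sub>N(k) x\<^sup>k (1 + x)\<^bsup>N-k\<^esup>\<close>
  with \<open>g\<^bsub>N+1\<^esub>(k) = (k + 1) g\<^sub>N(k) + (N + 3 - 2k) g\<^sub>N(k - 1)\<close>
  (\<open>turn_poly_eq_homog\<close>). A sum-of-squares identity shows that this recurrence does
  preserve log-concavity (\<open>strongly_log_concave_peak_coeff\<close>).

  It remains to pass from \<open>g\<^sub>N\<close> to the ordinary coefficients. The coefficient of
  \<open>x\<^bsup>N-m\<^esup>\<close> in \<open>\<Sum>\<^sub>k u(k) x\<^sup>k (1 + x)\<^bsup>N-k\<^esup>\<close> is the \<open>(m + 1)\<close>-fold iterated partial sum of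
  \<open>u\<close> at \<open>N - m\<close> (\<open>coeff_homog\<close>). Partial sums preserve log-concavity, and three
  consecutive coefficients have the form \<open>W(i), V(i + 1), v(i + 2)\<close>, where \<open>v\<close> is log-concave, \<open>V\<close>
  consists of the partial sums of \<open>v\<close> and \<open>W\<close> of those of \<open>V\<close>; to these \<open>psum_cross\<close> applies.
\<close>

section \<open>Strongly log-concave sequences and their partial sums\<close>

text \<open>
  The condition says that the ratios \<open>u (i + 1) / u i\<close> weakly decrease, cleared of
  denominators. Comparing all pairs \<open>j \<le> i\<close>, rather than neighbours only, also excludes
  internal zeros and makes the notion stable under partial sums.
\<close>

definition strongly_log_concave :: "(nat \<Rightarrow> int) \<Rightarrow> bool" where
  "strongly_log_concave u \<longleftrightarrow> (\<forall>i. 0 \<le> u i) \<and> (\<forall>i j. j \<le> i \<longrightarrow> u (Suc i) * u j \<le> u i * u (Suc j))"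

definition psum :: "(nat \<Rightarrow> int) \<Rightarrow> nat \<Rightarrow> int" where
  "psum u i = (\<Sum>j\<le>i. u j)"

lemma psum_0 [simp]: "psum u 0 = u 0"
  by (simp add: psum_def)

lemma psum_Suc [simp]: "psum u (Suc i) = psum u i + u (Suc i)"
  by (simp add: psum_def)

lemma strongly_log_concaveD:
  assumes "strongly_log_concave u" "j \<le> i"
  shows "u (Suc i) * u j \<le> u i * u (Suc j)"
  using assms by (auto simp: strongly_log_concave_def)

lemma strongly_log_concave_nonneg:
  "strongly_log_concave u \<Longrightarrow> 0 \<le> u i"
  by (auto simp: strongly_log_concave_def)

lemma strongly_log_concave_shift:
  assumes u: "strongly_log_concave u" and "j \<le> i"
  shows "u (i + s) * u j \<le> u i * u (j + s)"
  using \<open>j \<le> i\<close>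
proof (induction s arbitrary: j)
  case (Suc s)
  show ?case
  proof (cases "j = i")
    case False
    have "u (i + Suc s) * u j \<le> u (i + s) * u (Suc j)"
      using strongly_log_concaveD[OF u, of j "i + s"] Suc.prems by simp
    also have "\<dots> \<le> u i * u (Suc j + s)"
      using Suc.IH[of "Suc j"] Suc.prems False by simp
    finally show ?thesis by simp
  qed simp
qed simp

text \<open>
  For a sequence that stays zero once it vanishes, the inequalities between neighbours chain up
  to all pairs, since the common factor \<open>u (i + 1)\<close> can be cancelled while it is positive.
\<close>

lemma log_concave_imp_strongly:
  assumes nonneg: "\<And>i. 0 \<le> u i"
    and lc: "\<And>i. u i * u (Suc (Suc i)) \<le> (u (Suc i))\<^sup>2"
    and supp: "\<And>i. u i = 0 \<Longrightarrow> u (Suc i) = 0"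
  shows "strongly_log_concave u"
proof -
  have "u (Suc i) * u j \<le> u i * u (Suc j)" if "j \<le> i" for i j
    using that
  proof (induction i rule: dec_induct)
    case (step i)
    show ?case
    proof (cases "u (Suc i) = 0")
      case True
      then show ?thesis using supp[OF True] by simp
    next
      case False
      then have pos: "0 < u (Suc i)" using nonneg[of "Suc i"] by simp
      have "u (Suc i) * (u (Suc (Suc i)) * u j) = u (Suc (Suc i)) * (u (Suc i) * u j)"
        by simp
      also have "\<dots> \<le> u (Suc (Suc i)) * (u i * u (Suc j))"
        using step.IH nonneg by (intro mult_left_mono)
      also have "\<dots> = (u i * u (Suc (Suc i))) * u (Suc j)"
        by simp
      also have "\<dots> \<le> (u (Suc i))\<^sup>2 * u (Suc j)"
        using lc nonneg by (intro mult_right_mono)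
      finally have "u (Suc i) * (u (Suc (Suc i)) * u j) \<le> u (Suc i) * (u (Suc i) * u (Suc j))"
        by (simp add: power2_eq_square mult.assoc)
      then show ?thesis using pos by (simp only: mult_le_cancel_left_pos)
    qed
  qed simp
  then show ?thesis using nonneg by (simp add: strongly_log_concave_def)
qed

text \<open>
  Both sides are sums of products of two entries of \<open>u\<close> with the same index sum.
  Shifting by \<open>i - j\<close> matches each term on the left with one on the right whose indices are
  closer together.
\<close>

lemma psum_ratio_decreasing:
  assumes u: "strongly_log_concave u" and "j \<le> i"
  shows "u (Suc i) * psum u j \<le> psum u i * u (Suc j)"
proof -
  have "u (Suc i) * psum u j = (\<Sum>l\<le>j. u (Suc j + (i - j)) * u l)"
    using \<open>j \<le> i\<close> by (simp add: psum_def sum_distrib_left)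
  also have "\<dots> \<le> (\<Sum>l\<le>j. u (Suc j) * u (l + (i - j)))"
    by (intro sum_mono strongly_log_concave_shift[OF u]) simp
  also have "\<dots> = u (Suc j) * (\<Sum>l\<in>(\<lambda>l. l + (i - j)) ` {..j}. u l)"
    by (simp add: sum_distrib_left sum.reindex)
  also have "\<dots> \<le> u (Suc j) * psum u i"
    unfolding psum_def using \<open>j \<le> i\<close> strongly_log_concave_nonneg[OF u]
    by (intro mult_left_mono sum_mono2) auto
  finally show ?thesis by (simp add: mult.commute)
qed

lemma strongly_log_concave_psum:
  assumes u: "strongly_log_concave u"
  shows "strongly_log_concave (psum u)"
proof -
  have "psum u (Suc i) * psum u j \<le> psum u i * psum u (Suc j)" if "j \<le> i" for i j
    using psum_ratio_decreasing[OF u that] by (simp add: algebra_simps)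
  moreover have "0 \<le> psum u i" for i
    unfolding psum_def by (intro sum_nonneg strongly_log_concave_nonneg[OF u])
  ultimately show ?thesis by (simp add: strongly_log_concave_def)
qed

lemma strongly_log_concave_funpow_psum:
  "strongly_log_concave u \<Longrightarrow> strongly_log_concave ((psum ^^ m) u)"
  by (induction m) (simp_all add: strongly_log_concave_psum)

text \<open>
  With \<open>U\<close> the partial sums of \<open>u\<close>, the ratio \<open>u (j + 1) / U j\<close> decreases in \<open>j\<close>. So
  \<open>u (i + 2) U j \<le> U (i + 1) u (j + 1)\<close> for all \<open>j \<le> i\<close>, and summing over \<open>j\<close> gives the
  claim. This compares sequences at three different levels of summation, which is what
  neighbouring coefficients in \<open>coeff_homog\<close> are.
\<close>

lemma psum_cross:
  assumes u: "strongly_log_concave u"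
  shows "u (Suc (Suc i)) * psum (psum u) i \<le> (psum u (Suc i))\<^sup>2"
proof -
  have "u (Suc (Suc i)) * psum (psum u) i = (\<Sum>j\<le>i. u (Suc (Suc i)) * psum u j)"
    unfolding psum_def[of "psum u"] by (simp add: sum_distrib_left)
  also have "\<dots> \<le> (\<Sum>j\<le>i. psum u (Suc i) * u (Suc j))"
    by (intro sum_mono psum_ratio_decreasing[OF u]) simp
  also have "\<dots> = psum u (Suc i) * (\<Sum>j\<le>i. u (Suc j))"
    by (simp add: sum_distrib_left)
  also have "\<dots> \<le> psum u (Suc i) * psum u (Suc i)"
  proof (rule mult_left_mono)
    show "(\<Sum>j\<le>i. u (Suc j)) \<le> psum u (Suc i)"
      unfolding psum_def sum.atMost_Suc_shift using strongly_log_concave_nonneg[OF u] by simp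
    show "0 \<le> psum u (Suc i)"
      using strongly_log_concave_nonneg[OF strongly_log_concave_psum[OF u]] .
  qed
  finally show ?thesis by (simp add: power2_eq_square)
qed

section \<open>Expansions in the basis \<open>x\<^sup>k (1 + x)\<^bsup>N - k\<^esup>\<close>\<close>

definition homog :: "(nat \<Rightarrow> int) \<Rightarrow> nat \<Rightarrow> int poly" where
  "homog u N = (\<Sum>k\<le>N. smult (u k) ([:0, 1:] ^ k * [:1, 1:] ^ (N - k)))"

lemma homog_Suc: "homog u (Suc N) = [:1, 1:] * homog u N + monom (u (Suc N)) (Suc N)"
proof -
  have "(\<Sum>k\<le>N. smult (u k) ([:0, 1:] ^ k * [:1, 1:] ^ (Suc N - k))) = [:1, 1:] * homog u N"
    unfolding homog_def sum_distrib_left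
  proof (rule sum.cong)
    fix k assume "k \<in> {..N}"
    then have "Suc N - k = Suc (N - k)" by auto
    then show "smult (u k) ([:0, 1:] ^ k * [:1, 1:] ^ (Suc N - k))
        = [:1, 1:] * smult (u k) ([:0, 1:] ^ k * [:1, 1:] ^ (N - k))"
      by (simp only: power_Suc mult_smult_right mult.left_commute)
  qed simp
  then show ?thesis
    unfolding homog_def[of u "Suc N"] by (simp add: monom_altdef)
qed

lemma coeff_linear_mult:
  "coeff ([:1, 1:] * p) i = coeff p i + (if i = 0 then 0 else coeff p (i - 1))"
  for p :: "int poly"
  by (cases i) (simp_all)

lemma coeff_homog_eq_0: "N < i \<Longrightarrow> coeff (homog u N) i = 0"
proof (induction N arbitrary: i)
  case 0
  then show ?case by (cases i) (simp_all add: homog_def)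
next
  case (Suc N)
  then show ?case by (simp only: homog_Suc coeff_add coeff_linear_mult) simp
qed

text \<open>
  Multiplying by \<open>1 + x\<close> turns the Pascal rule for coefficients into the recurrence
  \<open>U (i + 1) = U i + u (i + 1)\<close> of partial sums, one level up for each step away from the
  leading coefficient.
\<close>

lemma coeff_homog: "coeff (homog u (i + m)) i = (psum ^^ Suc m) u i"
proof (induction "i + m" arbitrary: i m)
  case 0
  then show ?case by (simp add: homog_def)
next
  case (Suc N)
  have top: "coeff (homog u N) i + (if i = Suc N then u (Suc N) else 0) = (psum ^^ m) u i"
  proof (cases m)
    case 0
    then show ?thesis using Suc.hyps(2) by (simp add: coeff_homog_eq_0)
  next
    case (Suc m')
    then show ?thesis using Suc.hyps(1)[of i m'] Suc.hyps(2) by simp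
  qed
  show ?case
  proof (cases i)
    case 0
    then show ?thesis
      using top Suc.hyps(2)[symmetric]
      by (simp only: homog_Suc coeff_add coeff_linear_mult) simp
  next
    case (Suc i')
    have "coeff (homog u N) i' = (psum ^^ Suc m) u i'"
      using Suc.hyps(1)[of i' m] Suc.hyps(2) Suc by simp
    then show ?thesis
      using top Suc Suc.hyps(2)[symmetric]
      by (simp only: homog_Suc coeff_add coeff_linear_mult) auto
  qed
qed

text \<open>
  Up to reversal of coefficients this is the classical fact that \<open>f(x) \<mapsto> f(1 + x)\<close>
  preserves log-concavity of nonnegative coefficients without internal zeros.
\<close>

theorem homog_log_concave:
  assumes u: "strongly_log_concave u"
  shows "coeff (homog u N) i * coeff (homog u N) (Suc (Suc i)) \<le> (coeff (homog u N) (Suc i))\<^sup>2"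
proof (cases "Suc (Suc i) \<le> N")
  case True
  define m where "m = N - Suc (Suc i)"
  define v where "v = (psum ^^ Suc m) u"
  have v: "strongly_log_concave v"
    unfolding v_def by (rule strongly_log_concave_funpow_psum[OF u])
  have N: "N = Suc (Suc i) + m" using True by (simp add: m_def)
  have "coeff (homog u N) (Suc (Suc i)) = v (Suc (Suc i))"
    unfolding v_def N by (rule coeff_homog)
  moreover have "coeff (homog u N) (Suc i) = psum v (Suc i)"
    using coeff_homog[of u "Suc i" "Suc m"] by (simp add: N v_def)
  moreover have "coeff (homog u N) i = psum (psum v) i"
    using coeff_homog[of u i "Suc (Suc m)"] by (simp add: N v_def)
  ultimately show ?thesis
    using psum_cross[OF v, of i] by (simp add: mult.commute)
qed (simp add: coeff_homog_eq_0)

section \<open>A triangular array governing alternating runs\<close>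

text \<open>
  The entry \<open>peak_coeff N k\<close> is \<open>2\<^bsup>k-N\<^esup>\<close> times the number of permutations of length
  \<open>N + 2\<close> with \<open>k\<close> interior peaks.
\<close>

primrec peak_coeff :: "nat \<Rightarrow> nat \<Rightarrow> int" where
  "peak_coeff 0 = (\<lambda>k. if k = 0 then 2 else 0)"
| "peak_coeff (Suc N) = (\<lambda>k. (int k + 1) * peak_coeff N k
     + (if k = 0 then 0 else (int N + 3 - 2 * int k) * peak_coeff N (k - 1)))"

text \<open>
  The factor \<open>N + 3 - 2k\<close> is positive as long as \<open>k - 1\<close> lies in the support
  \<open>{0..(N + 1) div 2}\<close> of the previous row, except that it vanishes at the end of the
  support when \<open>N\<close> is odd; hence the support grows only every other time, and negative
  factors meet only zero entries.
\<close>

lemma peak_coeff_support: "(k \<le> Suc N div 2 \<longrightarrow> 0 < peak_coeff N k) \<and> (Suc N div 2 < k \<longrightarrow> peak_coeff N k = 0)"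
proof (induction N arbitrary: k)
  case (Suc N)
  show ?case
  proof (cases k)
    case 0
    then show ?thesis using Suc.IH[of 0] by simp
  next
    case (Suc j)
    note IHk = Suc.IH[of "Suc j"] and IHj = Suc.IH[of j]
    consider "k \<le> Suc N div 2" | "k = Suc (Suc N div 2)" | "Suc (Suc N div 2) < k"
      by linarith
    then show ?thesis
    proof cases
      case 1
      then have "0 < int N + 3 - 2 * int k" using Suc by linarith
      moreover have "0 < peak_coeff N k" "0 < peak_coeff N j" using 1 Suc IHk IHj by auto
      ultimately have "0 < peak_coeff (Suc N) k" using Suc
        by (simp add: add_pos_pos)
      then show ?thesis using 1 by auto
    next
      case 2
      then have z: "peak_coeff N k = 0" and p: "0 < peak_coeff N j" using Suc IHk IHj by auto
      show ?thesis
      proof (cases "even N")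
        case True
        then have "k = Suc (Suc N) div 2" "int N + 3 - 2 * int k = 1"
          using 2 by (auto elim!: evenE)
        then show ?thesis using z p Suc by simp
      next
        case False
        then have "k > Suc (Suc N) div 2" "int N + 3 - 2 * int k = 0"
          using 2 by (auto elim!: oddE)
        then show ?thesis using z Suc by simp
      qed
    next
      case 3
      then have "peak_coeff N k = 0" "peak_coeff N j = 0" using Suc IHk IHj by auto
      then show ?thesis using 3 Suc by auto
    qed
  qed
qed auto

lemma peak_coeff_nonneg: "0 \<le> peak_coeff N k"
  using peak_coeff_support[of k N] by (cases "k \<le> Suc N div 2") auto

lemma peak_coeff_zero_Suc: "peak_coeff N k = 0 \<Longrightarrow> peak_coeff N (Suc k) = 0"
  using peak_coeff_support[of k N] peak_coeff_support[of "Suc k" N] by (cases "k \<le> Suc N div 2") auto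

text \<open>
  Here \<open>a, b, c, d\<close> are consecutive entries of a row and the three factors are consecutive
  entries of the next one. The cross terms alone would leave a deficit of \<open>4 b c\<close>, because
  one family of multipliers increases by \<open>1\<close> and the other decreases by \<open>2\<close>. The surplus
  \<open>f\<^sup>2 - (f - 1)(f + 1) = 1\<close> and \<open>h\<^sup>2 - (h + 2)(h - 2) = 4\<close> from the other terms completes
  it to the square \<open>(c - 2b)\<^sup>2\<close>.
\<close>

lemma linear_recurrence_log_concave_step:
  fixes f h a b c d :: int
  assumes "0 \<le> f - 1" "0 \<le> h - 2" and lc: "b * d \<le> c\<^sup>2" "a * c \<le> b\<^sup>2" "a * d \<le> b * c"
  shows "((f - 1) * b + (h + 2) * a) * ((f + 1) * d + (h - 2) * c) \<le> (f * c + h * b)\<^sup>2"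
proof -
  have "(f * c + h * b)\<^sup>2 - ((f - 1) * b + (h + 2) * a) * ((f + 1) * d + (h - 2) * c)
     = (f - 1) * (f + 1) * (c\<^sup>2 - b * d) + (h + 2) * (h - 2) * (b\<^sup>2 - a * c)
     + (f + 1) * (h + 2) * (b * c - a * d) + (c - 2 * b)\<^sup>2"
    by (simp add: algebra_simps power2_eq_square)
  also have "\<dots> \<ge> 0"
    using assms by (intro add_nonneg_nonneg mult_nonneg_nonneg) auto
  finally show ?thesis by simp
qed

lemma strongly_log_concave_peak_coeff: "strongly_log_concave (peak_coeff N)"
proof (induction N)
  case 0
  show ?case by (rule log_concave_imp_strongly) auto
next
  case (Suc N)
  show ?case
  proof (rule log_concave_imp_strongly)
    fix i
    show "peak_coeff (Suc N) i * peak_coeff (Suc N) (Suc (Suc i)) \<le> (peak_coeff (Suc N) (Suc i))\<^sup>2"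
      \<comment> \<open>Beyond the support of row \<open>N\<close> the third entry vanishes; inside it all multipliers are
          nonnegative.\<close>
    proof (cases "Suc i \<le> Suc N div 2")
      case False
      then have "peak_coeff (Suc N) (Suc (Suc i)) = 0"
        using peak_coeff_support[of "Suc (Suc i)" "Suc N"] by auto
      then show ?thesis by simp
    next
      case True
      define h where "h = int N + 1 - 2 * int i"
      \<comment> \<open>The entry to the left of column \<open>0\<close> is read as \<open>0\<close>.\<close>
      define a where "a = (if i = 0 then 0 else peak_coeff N (i - 1))"
      have h: "0 \<le> h - 2" using True by (auto simp: h_def)
      have lc1: "peak_coeff N i * peak_coeff N (Suc (Suc i)) \<le> (peak_coeff N (Suc i))\<^sup>2"
        using strongly_log_concaveD[OF Suc.IH, of i "Suc i"] by (simp add: power2_eq_square mult.commute)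
      have lc2: "a * peak_coeff N (Suc i) \<le> (peak_coeff N i)\<^sup>2"
        using strongly_log_concaveD[OF Suc.IH, of "i - 1" i]
        by (auto simp: a_def power2_eq_square mult.commute)
      have lc3: "a * peak_coeff N (Suc (Suc i)) \<le> peak_coeff N i * peak_coeff N (Suc i)"
        using strongly_log_concaveD[OF Suc.IH, of "i - 1" "Suc i"] peak_coeff_nonneg[of N]
        by (auto simp: a_def mult.commute)
      have g0: "peak_coeff (Suc N) i = ((int i + 2) - 1) * peak_coeff N i + (h + 2) * a"
        by (simp add: a_def h_def algebra_simps)
      have g1: "peak_coeff (Suc N) (Suc i) = (int i + 2) * peak_coeff N (Suc i) + h * peak_coeff N i"
        by (simp add: h_def algebra_simps)
      have g2: "peak_coeff (Suc N) (Suc (Suc i))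
          = ((int i + 2) + 1) * peak_coeff N (Suc (Suc i)) + (h - 2) * peak_coeff N (Suc i)"
        by (simp add: h_def algebra_simps)
      show ?thesis
        unfolding g0 g1 g2
        by (rule linear_recurrence_log_concave_step[OF _ h lc1 lc2 lc3]) simp
    qed
  qed (use peak_coeff_nonneg peak_coeff_zero_Suc in blast)+
qed

section \<open>Inserting a new maximum\<close>

fun turns :: "nat list \<Rightarrow> nat" where
  "turns (a # b # c # xs) = (if (a < b) = (b < c) then 0 else 1) + turns (b # c # xs)"
| "turns xs = 0"

definition insert_at :: "nat \<Rightarrow> 'a \<Rightarrow> 'a list \<Rightarrow> 'a list" where
  "insert_at i y xs = take i xs @ y # drop i xs"

lemma insert_at_0 [simp]: "insert_at 0 y xs = y # xs"
  by (simp add: insert_at_def)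

lemma insert_at_Suc [simp]: "insert_at (Suc i) y (x # xs) = x # insert_at i y xs"
  by (simp add: insert_at_def)

text \<open>
  After a descent only the fact that it descends matters: behind \<open>c\<close>, the new maximum
  produces the same turns as any other larger predecessor of \<open>c\<close>.
\<close>

lemma turns_Cons_same:
  "c < b \<Longrightarrow> c < b' \<Longrightarrow> turns (b # c # xs) = turns (b' # c # xs)"
  by (cases xs) auto

text \<open>
  The sum runs over all insertions behind the first entry. The insertion in front creates a
  turn iff the word starts with an ascent, so removing it from the total in
  \<open>sum_turns_insert\<close> leaves a formula that depends on the first step. In this form the
  claim can be proved by induction from the left: dropping the first entry shifts all but the
  first two insertions by a constant number \<open>e\<close> of turns.
\<close>

lemma sum_turns_insert_inner:
  fixes x :: "'a :: comm_ring_1"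
  assumes "distinct (a # b # xs)" "\<forall>y\<in>set (a # b # xs). y < M"
  shows "(\<Sum>i\<le>Suc (length xs). x ^ turns (a # insert_at i M (b # xs)))
    = x ^ turns (a # b # xs) *
      ((if a < b then of_nat (turns (a # b # xs)) + 1 + x else of_nat (turns (a # b # xs)) + 2 * x)
       + (of_nat (length xs) - of_nat (turns (a # b # xs))) * x\<^sup>2)"
  using assms
proof (induction xs arbitrary: a b)
  case Nil
  then show ?case by auto
next
  case (Cons c xs)
  define t where "t = turns (b # c # xs)"
  define w where "w = turns (b # M # c # xs)"
  define e where "e = (if (a < b) = (b < c) then 0 else 1 :: nat)"
  define G where "G = (\<Sum>i\<le>length xs. x ^ turns (b # c # insert_at i M xs))"
  have IH: "x ^ w + G = x ^ t * ((if b < c then of_nat t + 1 + x else of_nat t + 2 * x)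
       + (of_nat (length xs) - of_nat t) * x\<^sup>2)"
    using Cons.IH[of b c] Cons.prems
    by (simp add: sum.atMost_Suc_shift t_def w_def G_def del: sum.atMost_Suc turns.simps)
  have G: "G = x ^ t * ((if b < c then of_nat t + 1 + x else of_nat t + 2 * x)
       + (of_nat (length xs) - of_nat t) * x\<^sup>2) - x ^ w"
    unfolding IH[symmetric] by simp
  have lt: "a < M" "b < M" "c < M" and ne: "a \<noteq> b" "b \<noteq> c" using Cons.prems by auto
  have ins: "turns (a # b # c # insert_at i M xs) = e + turns (b # c # insert_at i M xs)" for i
    by (simp add: e_def)
  have "(\<Sum>i\<le>Suc (length (c # xs)). x ^ turns (a # insert_at i M (b # c # xs)))
      = x ^ turns (a # M # b # c # xs) + x ^ turns (a # b # M # c # xs) + x ^ e * G"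
    by (simp add: sum.atMost_Suc_shift G_def ins power_add sum_distrib_left
        del: sum.atMost_Suc turns.simps)
  also have "turns (a # M # b # c # xs) = 1 + (if b < c then 1 else 0) + t"
    using lt ne by (auto simp: t_def)
  also have "turns (a # b # M # c # xs) = (if a < b then 0 else 1) + w"
    using lt by (simp add: w_def)
  finally have S: "(\<Sum>i\<le>Suc (length (c # xs)). x ^ turns (a # insert_at i M (b # c # xs)))
      = x ^ (1 + (if b < c then 1 else 0) + t) + x ^ ((if a < b then 0 else 1) + w)
        + x ^ e * (x ^ t * ((if b < c then of_nat t + 1 + x else of_nat t + 2 * x)
       + (of_nat (length xs) - of_nat t) * x\<^sup>2) - x ^ w)"
    by (simp only: G)
  \<comment> \<open>When \<open>b < c\<close>, the power \<open>x ^ w\<close> cancels; otherwise its exponent is needed.\<close>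
  have w: "w = Suc t" if "\<not> b < c"
    using that lt ne turns_Cons_same[of c b M xs] by (simp add: w_def t_def)
  have t': "turns (a # b # c # xs) = e + t"
    by (simp add: e_def t_def)
  show ?case
    unfolding S t' using w
    by (cases "a < b"; cases "b < c")
       (simp_all add: e_def algebra_simps power2_eq_square)
qed

text \<open>
  Each of the \<open>turns xs + 1\<close> runs offers exactly one place that creates no new turn: next
  to its largest entry, within the run if that entry is a peak inside the word, and outside
  if it is an end of the word. At each end of the word exactly one place creates one new turn. Every
  other place creates two.
\<close>

lemma sum_turns_insert:
  fixes x :: "'a :: comm_ring_1"
  assumes "distinct xs" "\<forall>y\<in>set xs. y < M" "length xs = Suc (Suc n)"
  shows "(\<Sum>i\<le>length xs. x ^ turns (insert_at i M xs))
    = x ^ turns xs * (1 + of_nat (turns xs) + 2 * x + (of_nat n - of_nat (turns xs)) * x\<^sup>2)"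
proof -
  obtain a b ys where xs: "xs = a # b # ys" and n: "n = length ys"
    using assms(3) by (auto simp: length_Suc_conv)
  have "(\<Sum>i\<le>length xs. x ^ turns (insert_at i M xs))
      = x ^ turns (M # a # b # ys) + (\<Sum>i\<le>Suc (length ys). x ^ turns (a # insert_at i M (b # ys)))"
    by (simp add: xs sum.atMost_Suc_shift del: sum.atMost_Suc turns.simps)
  also have "turns (M # a # b # ys) = (if a < b then 1 else 0) + turns xs"
    using assms(1,2) by (auto simp: xs)
  finally show ?thesis
    using sum_turns_insert_inner[of a b ys M x] assms(1,2)
    by (simp add: xs n algebra_simps del: sum.atMost_Suc turns.simps)
qed

text \<open>
  Injectivity holds because the new maximum marks the place of insertion; surjectivity then
  follows from \<open>n! (n + 1) = (n + 1)!\<close>.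
\<close>

lemma bij_betw_insert_at:
  "bij_betw (\<lambda>(xs, i). insert_at i (Suc n) xs)
     (permutations_of_set {1..n} \<times> {..n}) (permutations_of_set {1..Suc n})"
proof -
  let ?f = "\<lambda>(xs, i). insert_at i (Suc n) xs"
  let ?D = "permutations_of_set {1..n} \<times> {..n}"
  have inj: "inj_on ?f ?D"
  proof (rule inj_onI)
    fix P Q assume P: "P \<in> ?D" and Q: "Q \<in> ?D" and PQ: "?f P = ?f Q"
    obtain xs i ys j where PQ_eq: "P = (xs, i)" "Q = (ys, j)" by (metis surj_pair)
    have xs: "xs \<in> permutations_of_set {1..n}" and ys: "ys \<in> permutations_of_set {1..n}"
      and ij: "i \<in> {..n}" "j \<in> {..n}" and eq: "insert_at i (Suc n) xs = insert_at j (Suc n) ys"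
      using P Q PQ by (auto simp: PQ_eq)
    have len: "length xs = n" "length ys = n"
      using xs ys length_finite_permutations_of_set by fastforce+
    have notin: "Suc n \<notin> set xs" "Suc n \<notin> set ys"
      using xs ys by (auto simp: permutations_of_set_def)
    have "take i xs = take j ys \<and> drop i xs = drop j ys"
      using eq notin unfolding insert_at_def
      by (subst (asm) append_Cons_eq_iff) (auto dest: in_set_takeD in_set_dropD)
    then show "P = Q"
      unfolding PQ_eq using len ij by (metis append_take_drop_id atMost_iff length_take min.absorb2)
  qed
  moreover have "?f ` ?D = permutations_of_set {1..Suc n}"
  proof (rule card_subset_eq)
    show "?f ` ?D \<subseteq> permutations_of_set {1..Suc n}"
    proof
      fix zs assume "zs \<in> ?f ` ?D"
      then obtain xs i where xs: "xs \<in> permutations_of_set {1..n}"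
        and zs: "zs = insert_at i (Suc n) xs" by auto
      have split: "xs = take i xs @ drop i xs" by simp
      have "set xs = {1..n}" "distinct xs"
        using xs by (simp_all add: permutations_of_set_def)
      then have d: "distinct (take i xs @ drop i xs)" and s: "set (take i xs) \<union> set (drop i xs) = {1..n}"
        using split by (simp_all flip: set_append)
      have "set zs = insert (Suc n) (set (take i xs) \<union> set (drop i xs))"
        unfolding zs insert_at_def by (simp only: set_append set_simps Un_insert_right)
      also have "\<dots> = insert (Suc n) {1..n}"
        by (simp only: s)
      also have "\<dots> = {1..Suc n}"
        by (rule atLeastAtMostSuc_conv[symmetric]) simp
      finally have set_zs: "set zs = {1..Suc n}" .
      have "Suc n \<notin> {1..n}" by simp
      then have "Suc n \<notin> set (take i xs) \<union> set (drop i xs)"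
        by (simp only: s not_False_eq_True)
      then have "distinct zs"
        using d unfolding zs insert_at_def distinct_append distinct.simps list.set by blast
      with set_zs show "zs \<in> permutations_of_set {1..Suc n}"
        by (simp only: permutations_of_set_def mem_Collect_eq)
    qed
    show "card (?f ` ?D) = card (permutations_of_set {1..Suc n})"
      by (subst card_image[OF inj]) (simp add: card_cartesian_product)
  qed simp
  ultimately show ?thesis by (simp add: bij_betw_def)
qed

section \<open>The generating polynomial of alternating runs\<close>

definition turn_poly :: "nat \<Rightarrow> int poly" where
  "turn_poly n = (\<Sum>xs\<in>permutations_of_set {1..n}. monom 1 (turns xs))"

lemma smult_of_nat: "smult (int n) p = of_nat n * p"
  by (simp add: of_nat_poly)

lemma mult_pderiv_power:
  fixes p :: "int poly"
  assumes "pderiv p = 1"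
  shows "p * pderiv (p ^ k) = of_nat k * p ^ k"
proof (cases k)
  case (Suc n)
  then have "pderiv (p ^ k) = of_nat k * p ^ n"
    by (simp only: pderiv_power_Suc assms smult_of_nat mult_1_right)
  then show ?thesis by (simp add: Suc del: of_nat_Suc)
qed simp

text \<open>
  The operator that inserting a maximum induces on generating polynomials. The number of turns
  enters the insertion formula as a factor, and \<open>x d/dx\<close> produces that factor on \<open>x\<^sup>c\<close>.
\<close>

definition run_op :: "nat \<Rightarrow> int poly \<Rightarrow> int poly" where
  "run_op N p = (1 + 2 * [:0, 1:] + of_nat N * [:0, 1:]\<^sup>2) * p + ([:0, 1:] - [:0, 1:] ^ 3) * pderiv p"

lemma run_op_sum: "run_op N (\<Sum>i\<in>A. p i) = (\<Sum>i\<in>A. run_op N (p i))"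
  by (simp add: run_op_def higher_pderiv_sum[of "Suc 0", simplified] sum_distrib_left sum.distrib)

lemma run_op_smult: "run_op N (smult c p) = smult c (run_op N p)"
  by (simp add: run_op_def pderiv_smult smult_add_right)

lemma turn_poly_Suc: "turn_poly (Suc (Suc (Suc N))) = run_op N (turn_poly (Suc (Suc N)))"
proof -
  let ?n = "Suc (Suc N)"
  define X where "X = [:0, 1 :: int:]"
  have "turn_poly (Suc ?n) = (\<Sum>zs\<in>permutations_of_set {1..Suc ?n}. X ^ turns zs)"
    by (simp add: turn_poly_def monom_altdef X_def)
  also have "\<dots> = (\<Sum>xs\<in>permutations_of_set {1..?n}. \<Sum>i\<le>?n. X ^ turns (insert_at i (Suc ?n) xs))"
    by (subst sum.reindex_bij_betw[OF bij_betw_insert_at, symmetric])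
       (simp add: sum.cartesian_product case_prod_unfold del: sum.atMost_Suc)
  also have "\<dots> = (\<Sum>xs\<in>permutations_of_set {1..?n}. run_op N (X ^ turns xs))"
  proof (rule sum.cong)
    fix xs assume xs: "xs \<in> permutations_of_set {1..?n}"
    have len: "length xs = ?n"
      using length_finite_permutations_of_set[OF xs] by simp
    have "(\<Sum>i\<le>?n. X ^ turns (insert_at i (Suc ?n) xs))
       = X ^ turns xs * (1 + of_nat (turns xs) + 2 * X + (of_nat N - of_nat (turns xs)) * X\<^sup>2)"
      using sum_turns_insert[of xs "Suc ?n" N X] xs len
      by (auto simp: permutations_of_set_def simp del: sum.atMost_Suc)
    also have "\<dots> = (1 + 2 * X + of_nat N * X\<^sup>2) * X ^ turns xs
        + (1 - X\<^sup>2) * (of_nat (turns xs) * X ^ turns xs)"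
      by (simp add: algebra_simps)
    also have "of_nat (turns xs) * X ^ turns xs = X * pderiv (X ^ turns xs)"
      unfolding X_def by (rule mult_pderiv_power[symmetric]) (simp add: pderiv_pCons)
    finally show "(\<Sum>i\<le>?n. X ^ turns (insert_at i (Suc ?n) xs)) = run_op N (X ^ turns xs)"
      unfolding run_op_def X_def[symmetric] by (simp add: algebra_simps power2_eq_square power3_eq_cube)
  qed simp
  also have "\<dots> = run_op N (turn_poly ?n)"
    by (simp add: turn_poly_def monom_altdef X_def run_op_sum)
  finally show ?thesis .
qed

text \<open>
  This is the reason for the basis \<open>x\<^sup>k (1 + x)\<^sup>d\<close>: after dividing by the basis element, the
  image is a priori a quadratic polynomial, but its \<open>x\<^sup>2\<close> term cancels and only two
  neighbouring basis elements remain.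
\<close>

lemma run_op_basis:
  "run_op (k + d) ([:0, 1:] ^ k * [:1, 1:] ^ d)
    = smult (int k + 1) ([:0, 1:] ^ k * [:1, 1:] ^ Suc d)
    + smult (int d + 1 - int k) ([:0, 1:] ^ Suc k * [:1, 1:] ^ d)"
proof -
  define X where "X = [:0, 1 :: int:]"
  define Y where "Y = [:1, 1 :: int:]"
  have Y: "Y = 1 + X" by (simp add: X_def Y_def one_pCons)
  have "(X - X ^ 3) * pderiv (X ^ k * Y ^ d)
     = (1 - X) * (Y * Y ^ d * (X * pderiv (X ^ k)) + X * X ^ k * (Y * pderiv (Y ^ d)))"
    by (simp add: pderiv_mult Y algebra_simps power3_eq_cube)
  also have "X * pderiv (X ^ k) = of_nat k * X ^ k"
    unfolding X_def by (rule mult_pderiv_power) (simp add: pderiv_pCons)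
  also have "Y * pderiv (Y ^ d) = of_nat d * Y ^ d"
    unfolding Y_def by (rule mult_pderiv_power) (simp add: pderiv_pCons)
  finally have "run_op (k + d) (X ^ k * Y ^ d)
     = (1 + 2 * X + (of_nat k + of_nat d) * X\<^sup>2
         + (1 - X) * (of_nat k * (1 + X) + of_nat d * X)) * (X ^ k * Y ^ d)"
    unfolding run_op_def X_def[symmetric] Y by (simp add: algebra_simps)
  also have "\<dots> = (of_nat k + 1) * (X ^ k * Y ^ Suc d)
      + (of_nat d + 1 - of_nat k) * (X ^ Suc k * Y ^ d)"
    by (simp add: Y algebra_simps power2_eq_square)
  also have "\<dots> = smult (int k + 1) (X ^ k * Y ^ Suc d)
      + smult (int d + 1 - int k) (X ^ Suc k * Y ^ d)"
    by (simp add: smult_add_left smult_diff_left smult_of_nat algebra_simps)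
  finally show ?thesis by (simp only: X_def Y_def)
qed

lemma run_op_homog_peak_coeff: "run_op N (homog (peak_coeff N) N) = homog (peak_coeff (Suc N)) (Suc N)"
proof -
  let ?B = "\<lambda>k. [:0, 1 :: int:] ^ k * [:1, 1:] ^ (Suc N - k)"
  let ?c = "\<lambda>k. int N + 3 - 2 * int k"
  have "run_op N (homog (peak_coeff N) N)
    = (\<Sum>k\<le>N. smult ((int k + 1) * peak_coeff N k) (?B k)) + (\<Sum>k\<le>N. smult (?c (Suc k) * peak_coeff N k) (?B (Suc k)))"
    unfolding homog_def run_op_sum run_op_smult sum.distrib[symmetric]
  proof (rule sum.cong)
    fix k assume "k \<in> {..N}"
    then obtain d where N: "N = k + d" by (auto simp: le_iff_add)
    have c: "?c (Suc k) = int d + 1 - int k" and d: "N - k = d" "Suc N - k = Suc d" "Suc N - Suc k = d"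
      by (simp_all add: N)
    show "smult (peak_coeff N k) (run_op N ([:0, 1:] ^ k * [:1, 1:] ^ (N - k)))
        = smult ((int k + 1) * peak_coeff N k) (?B k) + smult (?c (Suc k) * peak_coeff N k) (?B (Suc k))"
      by (simp only: c d run_op_basis[of k d, folded N] smult_add_right smult_smult
          mult.commute[of "peak_coeff N k"])
  qed simp
  also have "(\<Sum>k\<le>N. smult ((int k + 1) * peak_coeff N k) (?B k))
      = (\<Sum>k\<le>Suc N. smult ((int k + 1) * peak_coeff N k) (?B k))"
    using peak_coeff_support[of "Suc N" N] by simp
  also have "(\<Sum>k\<le>N. smult (?c (Suc k) * peak_coeff N k) (?B (Suc k)))
      = (\<Sum>k\<le>Suc N. smult (if k = 0 then 0 else ?c k * peak_coeff N (k - 1)) (?B k))"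
    by (simp add: sum.atMost_Suc_shift del: sum.atMost_Suc)
  finally show ?thesis
    by (simp only: homog_def peak_coeff.simps sum.distrib[symmetric] smult_add_left[symmetric])
qed

theorem turn_poly_eq_homog: "turn_poly (Suc (Suc N)) = homog (peak_coeff N) N"
proof (induction N)
  case 0
  have "turns xs = 0" if "xs \<in> permutations_of_set {1..2}" for xs
  proof -
    have "length xs = 2" using length_finite_permutations_of_set[OF that] by simp
    then show ?thesis by (auto simp: length_Suc_conv numeral_2_eq_2)
  qed
  then have "turn_poly 2 = (\<Sum>xs\<in>permutations_of_set {1..2::nat}. 1)"
    unfolding turn_poly_def by (intro sum.cong) (simp_all add: one_pCons)
  then show ?case by (simp add: homog_def numeral_2_eq_2 one_pCons)
next
  case (Suc N)
  then show ?case by (simp only: turn_poly_Suc run_op_homog_peak_coeff)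
qed

section \<open>From permutations as functions to permutations as lists\<close>

lemma bij_betw_one_line:
  "bij_betw (\<lambda>p. map p [1..<Suc n]) {p. p permutes {1..n}} (permutations_of_set {1..n})"
proof -
  let ?f = "\<lambda>p :: nat \<Rightarrow> nat. map p [1..<Suc n]"
  have inj: "inj_on ?f {p. p permutes {1..n}}"
  proof (rule inj_onI)
    fix p q assume pq: "p \<in> {p. p permutes {1..n}}" "q \<in> {p. p permutes {1..n}}" "?f p = ?f q"
    have "\<forall>i\<in>set [1..<Suc n]. p i = q i"
      using pq(3) by (simp only: map_eq_conv)
    then have "p i = q i" if "i \<in> {1..n}" for i
      using that by (simp del: upt_Suc)
    then show "p = q"
      using pq(1,2) by (metis mem_Collect_eq permutes_not_in ext)
  qed
  moreover have "?f ` {p. p permutes {1..n}} = permutations_of_set {1..n}"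
  proof (rule card_subset_eq)
    show "?f ` {p. p permutes {1..n}} \<subseteq> permutations_of_set {1..n}"
    proof clarify
      fix p assume p: "p permutes {1..n}"
      have "set [1..<Suc n] = {1..n}" by auto
      then show "?f p \<in> permutations_of_set {1..n}"
        using permutes_image[OF p] permutes_inj_on[OF p]
        by (simp add: permutations_of_set_def distinct_map del: upt_Suc)
    qed
    show "card (?f ` {p. p permutes {1..n}}) = card (permutations_of_set {1..n})"
      by (subst card_image[OF inj]) (simp add: card_permutations[of _ n])
  qed simp
  ultimately show ?thesis by (simp add: bij_betw_def)
qed

text \<open>
  Stated for an arbitrary window \<open>{m..<m + n}\<close> so that the induction can drop the first
  entry of the word.
\<close>

lemma turns_map_upt:
  assumes "inj_on p {m..<m + n}"
  shows "turns (map p [m..<m + n]) = card {i \<in> {Suc m..<m + n - 1}. changes_direction_at p i}"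
  using assms
proof (induction n arbitrary: m)
  case 0
  then show ?case by simp
next
  case (Suc n)
  show ?case
  proof (cases "n < 2")
    case True
    then have "n = 0 \<or> n = 1" by auto
    then show ?thesis by auto
  next
    case False
    then obtain l where n: "n = Suc (Suc l)"
      by (metis One_nat_def Suc_1 add_2_eq_Suc le_Suc_ex not_less)
    let ?S = "\<lambda>m. {i \<in> {Suc m..<m + n}. changes_direction_at p i}"
    have ne: "p m \<noteq> p (Suc m)" "p (Suc m) \<noteq> p (Suc (Suc m))"
      using inj_onD[OF Suc.prems, of m "Suc m"] inj_onD[OF Suc.prems, of "Suc m" "Suc (Suc m)"]
      by (auto simp: n)
    have upt: "[m..<m + Suc n] = m # Suc m # Suc (Suc m) # [Suc (Suc (Suc m))..<m + Suc n]"
      "[Suc m..<Suc m + n] = Suc m # Suc (Suc m) # [Suc (Suc (Suc m))..<m + Suc n]"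
      by (simp_all add: n upt_conv_Cons del: upt_Suc)
    have IH: "turns (map p [Suc m..<Suc m + n])
        = card {i \<in> {Suc (Suc m)..<m + n}. changes_direction_at p i}"
      using Suc.IH[of "Suc m"] inj_on_subset[OF Suc.prems, of "{Suc m..<Suc m + n}"] by auto
    have turn: "changes_direction_at p (Suc m) \<longleftrightarrow> (p m < p (Suc m)) \<noteq> (p (Suc m) < p (Suc (Suc m)))"
      using ne by (auto simp: changes_direction_at_def)
    have S: "?S m = (if changes_direction_at p (Suc m) then {Suc m} else {})
        \<union> {i \<in> {Suc (Suc m)..<m + n}. changes_direction_at p i}"
      by (auto simp: n le_less Suc_le_eq)
    have "card (?S m) = (if changes_direction_at p (Suc m) then 1 else 0)
        + card {i \<in> {Suc (Suc m)..<m + n}. changes_direction_at p i}"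
      unfolding S by (subst card_Un_disjoint) auto
    moreover have "turns (map p [m..<m + Suc n])
        = (if changes_direction_at p (Suc m) then 1 else 0) + turns (map p [Suc m..<Suc m + n])"
      unfolding upt turn by simp
    ultimately show ?thesis using IH by simp
  qed
qed

lemma runs_eq_turns:
  assumes "p permutes {1..n}"
  shows "runs n p = Suc (turns (map p [1..<Suc n]))"
proof -
  have "{Suc 1..<1 + n - 1} = {2..n - 1}" by auto
  then show ?thesis
    using turns_map_upt[of p 1 n] permutes_inj_on[OF assms] by (simp add: runs_def del: upt_Suc)
qed

lemma R_eq_coeff: "int (R n (Suc k)) = coeff (turn_poly n) k"
proof -
  let ?P = "{p. p permutes {1..n}}"
  have "int (R n (Suc k)) = int (card {p \<in> ?P. turns (map p [1..<Suc n]) = k})"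
    unfolding R_def by (intro arg_cong[where f = "\<lambda>A. int (card A)"]) (auto simp: runs_eq_turns)
  also have "\<dots> = (\<Sum>p\<in>?P. if turns (map p [1..<Suc n]) = k then 1 else 0)"
    using finite_permutations[of "{1..n}"] by (simp add: sum.If_cases Int_def del: upt_Suc)
  also have "\<dots> = (\<Sum>xs\<in>permutations_of_set {1..n}. if turns xs = k then 1 else 0)"
    by (rule sum.reindex_bij_betw[OF bij_betw_one_line])
  also have "\<dots> = coeff (turn_poly n) k"
    by (simp add: turn_poly_def coeff_sum)
  finally show ?thesis .
qed

lemma coeff_run_poly:
  "coeff (run_poly (Suc (Suc N))) k = (if k = 0 then 0 else coeff (homog (peak_coeff N) N) (k - 1))"
proof -
  have "coeff (run_poly (Suc (Suc N))) k = (if k \<in> {1..Suc N} then int (R (Suc (Suc N)) k) else 0)"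
    by (simp add: run_poly_def coeff_sum)
  then show ?thesis
    by (cases k) (auto simp: R_eq_coeff turn_poly_eq_homog coeff_homog_eq_0)
qed

theorem theorem4p2:
  fixes n :: nat
  assumes "n \<ge> 1"
  shows "\<forall>k\<ge>1. coeff (run_poly n) (k - 1) * coeff (run_poly n) (k + 1) \<le> (coeff (run_poly n) k)\<^sup>2"
proof (cases "n = 1")
  case True
  then show ?thesis by (simp add: run_poly_def)
next
  case False
  then obtain N where n: "n = Suc (Suc N)"
    using assms by (metis One_nat_def Suc_le_D not0_implies_Suc)
  show ?thesis
  proof (intro allI impI)
    fix k :: nat assume "k \<ge> 1"
    then consider "k = 1" | i where "k = Suc (Suc i)"
      by (metis One_nat_def not0_implies_Suc not_one_le_zero)
    then show "coeff (run_poly n) (k - 1) * coeff (run_poly n) (k + 1) \<le> (coeff (run_poly n) k)\<^sup>2"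
    proof cases
      case 1
      then show ?thesis by (simp add: n coeff_run_poly)
    next
      case 2
      then show ?thesis
        using homog_log_concave[OF strongly_log_concave_peak_coeff, of N N i] by (simp add: n coeff_run_poly)
    qed
  qed
qed

end
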